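(* Let $g$ and $h_1,\dots,h_k$ be smooth ($C^\infty$) real-valued functions of $(x,y)$, with $x\in\mathcal X\subset\mathbb R^n$ and $y\in\mathbb R^m$, and let $\mathcal Y(x)=\{y\in\mathbb R^m: h_i(x,y)\le 0,\ i=1,\dots,k\}$ be nonempty for every $x\in\mathcal X$. Suppose that the upper-level feasible set $\mathcal X$ is a connected manifold with generalized boundary (MGB), and that the lower-level feasible set $\mathcal Y(x)$ is uniformly bounded for all $x\in\mathcal X$. Furthermore, assume that, at every $x\in\mathcal X$, LICQ and SCSC hold for the lower-level problem $\min_{y\in\mathcal Y(x)} g(x,y)$. Then, for any continuous trajectory of KKT points $y^\ast(x)$ parameterized by $x$ (a KKT trajectory, i.e. a continuous map $x\mapsto y^\ast(x)$ defined on a subset of $\mathcal X$ such that $y^\ast(x)$ is a KKT point of the lower-level problem at each $x$), the active constraint index set $\mathcal J(x,y^\ast(x))=\{i:h_i(x,y^\ast(x))=0\}$ remains constant. Consequently, no KKT point can migrate across different strata of $\mathcal Y(x)$ as $x$ varies.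
   Context: Active set: $\mathcal J(x,y)=\{i:h_i(x,y)=0\}$. Strata: for $\mathcal J\subseteq\{1,\dots,k\}$, the set $\mathcal S_{\mathcal J}(x)=\{y\in\mathcal Y(x):\mathcal J(x,y)=\mathcal J\}$ is treated as a single stratum of $\mathcal Y(x)$ (it is not refined into connected components). KKT: $(y,\lambda)\in\mathbb R^m\times\mathbb R^k$ is a KKT pair at $x$ if $\nabla_y g(x,y)+\sum_{i=1}^k\lambda_i\nabla_y h_i(x,y)=0$, $h_i(x,y)\le 0$, $\lambda_i\ge 0$, and $\lambda_i h_i(x,y)=0$ for all $i$; $y$ is a KKT point at $x$ if it belongs to some KKT pair at $x$. LICQ holds for the lower-level problem at $x$ if for every feasible $y\in\mathcal Y(x)$ the vectors $\{\nabla_y h_i(x,y): i\in\mathcal J(x,y)\}$ are linearly independent. SCSC (strict complementary slackness condition) holds for the lower-level problem at $x$ if for every KKT pair $(y^\ast,\lambda^\ast)$ at $x$ and every $i$, either $h_i(x,y^\ast)<0$ and $\lambda^\ast_i=0$, or $h_i(x,y^\ast)=0$ and $\lambda^\ast_i>0$. MGB: $X\subset\mathbb R^N$ is a manifold with generalized boundary if for each $p_0\in X$ there is a smooth local coordinate system $\psi:U\to V$ of $\mathbb R^N$ with $\psi(p_0)=0$ and integers $q,p\ge0$ (possibly depending on $p_0$) such that $\psi(U\cap X)=\{v\in V: v_1=\dots=v_q=0,\ v_{q+1}\ge0,\dots,v_{q+p}\ge0\}$. Connected means that it is not a disjoint union of two nonempty (relatively) open subsets. Uniformly bounded: there is $R>0$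 with $\mathcal Y(x)\subset\{y:\|y\|\le R\}$ for all $x\in\mathcal X$.
   Formalization: The KKT trajectory is assumed to be defined on a connected subset of X; on an arbitrary (e.g. two-point) subset the claim fails, since KKT points of different strata can be chosen on different pieces. *)

theory Defs
  imports "HOL-Analysis.Analysis"
begin

text \<open>C^r on an open set: derivatives are iterated one direction \<open>v\<close> at a time. The definition is
  only meant for open \<open>U\<close>, since \<^const>\<open>frechet_derivative\<close> is taken at \<open>x\<close> in the whole space.\<close>

primrec Cr_on :: "nat \<Rightarrow> 'a::euclidean_space set \<Rightarrow> ('a \<Rightarrow> 'b::euclidean_space) \<Rightarrow> bool" where
  "Cr_on 0 U f \<longleftrightarrow> continuous_on U f"
| "Cr_on (Suc r) U f \<longleftrightarrow>
     (\<forall>x\<in>U. f differentiable (at x)) \<and> (\<forall>v. Cr_on r U (\<lambda>x. frechet_derivative f (at x) v))"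

definition Cinf_on :: "'a::euclidean_space set \<Rightarrow> ('a \<Rightarrow> 'b::euclidean_space) \<Rightarrow> bool" where
  "Cinf_on U f \<longleftrightarrow> (\<forall>r. Cr_on r U f)"

text \<open>Smoothness on an arbitrary, not necessarily open, set \<open>S\<close>: local smooth extendability.
  For open \<open>S\<close> this is \<^const>\<open>Cinf_on\<close>.\<close>

definition smooth_on :: "'a::euclidean_space set \<Rightarrow> ('a \<Rightarrow> 'b::euclidean_space) \<Rightarrow> bool" where
  "smooth_on S f \<longleftrightarrow>
     (\<forall>s\<in>S. \<exists>U F. open U \<and> s \<in> U \<and> Cinf_on U F \<and> (\<forall>z\<in>S \<inter> U. F z = f z))"

definition diffeo :: "('a::euclidean_space \<Rightarrow> 'b::euclidean_space) \<Rightarrow> 'a set \<Rightarrow> 'b set \<Rightarrow> bool" where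
  "diffeo \<psi> U V \<longleftrightarrow>
     open U \<and> open V \<and> bij_betw \<psi> U V \<and> Cinf_on U \<psi> \<and> Cinf_on V (inv_into U \<psi>)"

text \<open>The index type \<open>'n\<close> carries no order, so the numbering \<open>v\<^sub>1, \<dots>, v\<^sub>N\<close> of the coordinates is
  supplied by an enumeration \<open>e\<close>. It may depend on the point; changing it permutes the coordinates
  of the chart, which is again a chart.\<close>

definition mgb :: "(real^'n) set \<Rightarrow> bool" where
  "mgb X \<longleftrightarrow>
     (\<forall>p0\<in>X. \<exists>\<psi> U (V :: (real^'n) set) (e :: nat \<Rightarrow> 'n) q p.
        diffeo \<psi> U V \<and> p0 \<in> U \<and> \<psi> p0 = 0 \<and>
        bij_betw e {1..CARD('n)} UNIV \<and> q + p \<le> CARD('n) \<and>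
        \<psi> ` (U \<inter> X) = {v\<in>V. (\<forall>i\<in>{1..q}. v $ e i = 0) \<and> (\<forall>i\<in>{q+1..q+p}. v $ e i \<ge> 0)})"

definition grad :: "('a::real_inner \<Rightarrow> real) \<Rightarrow> 'a \<Rightarrow> 'a" where
  "grad f y = (THE D. GDERIV f y :> D)"

text \<open>The constraint functions are \<open>h i\<close> for \<open>i \<in> {1..k}\<close>; values of \<open>h\<close> and of multipliers \<open>l\<close>
  at other indices are irrelevant.\<close>

definition feas :: "nat \<Rightarrow> (nat \<Rightarrow> 'a \<Rightarrow> 'b \<Rightarrow> real) \<Rightarrow> 'a \<Rightarrow> 'b set" where
  "feas k h x = {y. \<forall>i\<in>{1..k}. h i x y \<le> 0}"

definition active :: "nat \<Rightarrow> (nat \<Rightarrow> 'a \<Rightarrow> 'b \<Rightarrow> real) \<Rightarrow> 'a \<Rightarrow> 'b \<Rightarrow> nat set" where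
  "active k h x y = {i\<in>{1..k}. h i x y = 0}"

definition stratum :: "nat \<Rightarrow> (nat \<Rightarrow> 'a \<Rightarrow> 'b \<Rightarrow> real) \<Rightarrow> nat set \<Rightarrow> 'a \<Rightarrow> 'b set" where
  "stratum k h J x = {y\<in>feas k h x. active k h x y = J}"

definition kkt_pair ::
  "('a \<Rightarrow> 'b::real_inner \<Rightarrow> real) \<Rightarrow> nat \<Rightarrow> (nat \<Rightarrow> 'a \<Rightarrow> 'b \<Rightarrow> real) \<Rightarrow> 'a \<Rightarrow> 'b \<Rightarrow> (nat \<Rightarrow> real) \<Rightarrow> bool"
where
  "kkt_pair g k h x y l \<longleftrightarrow>
     grad (g x) y + (\<Sum>i\<in>{1..k}. l i *\<^sub>R grad (h i x) y) = 0 \<and>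
     (\<forall>i\<in>{1..k}. h i x y \<le> 0 \<and> l i \<ge> 0 \<and> l i * h i x y = 0)"

definition kkt_point ::
  "('a \<Rightarrow> 'b::real_inner \<Rightarrow> real) \<Rightarrow> nat \<Rightarrow> (nat \<Rightarrow> 'a \<Rightarrow> 'b \<Rightarrow> real) \<Rightarrow> 'a \<Rightarrow> 'b \<Rightarrow> bool"
where
  "kkt_point g k h x y \<longleftrightarrow> (\<exists>l. kkt_pair g k h x y l)"

text \<open>Linear independence is that of the indexed family of active gradients, hence the injectivity
  condition: two active constraints with equal gradients violate LICQ.\<close>

definition LICQ :: "nat \<Rightarrow> (nat \<Rightarrow> 'a \<Rightarrow> 'b::real_inner \<Rightarrow> real) \<Rightarrow> 'a \<Rightarrow> bool" where
  "LICQ k h x \<longleftrightarrow>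
     (\<forall>y\<in>feas k h x. inj_on (\<lambda>i. grad (h i x) y) (active k h x y) \<and>
        independent ((\<lambda>i. grad (h i x) y) ` active k h x y))"

definition SCSC ::
  "('a \<Rightarrow> 'b::real_inner \<Rightarrow> real) \<Rightarrow> nat \<Rightarrow> (nat \<Rightarrow> 'a \<Rightarrow> 'b \<Rightarrow> real) \<Rightarrow> 'a \<Rightarrow> bool"
where
  "SCSC g k h x \<longleftrightarrow>
     (\<forall>y l. kkt_pair g k h x y l \<longrightarrow>
        (\<forall>i\<in>{1..k}. h i x y < 0 \<and> l i = 0 \<or> h i x y = 0 \<and> l i > 0))"

text \<open>The domain \<open>D\<close> is an arbitrary subset here. Constancy of the active set can only be expected on
  connected domains: on a two-point \<open>D\<close> the values may be KKT points chosen in different strata.\<close>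

definition kkt_trajectory ::
  "('a::topological_space \<Rightarrow> 'b::real_inner \<Rightarrow> real) \<Rightarrow> nat \<Rightarrow> (nat \<Rightarrow> 'a \<Rightarrow> 'b \<Rightarrow> real) \<Rightarrow>
     'a set \<Rightarrow> 'a set \<Rightarrow> ('a \<Rightarrow> 'b) \<Rightarrow> bool"
where
  "kkt_trajectory g k h X D ys \<longleftrightarrow>
     D \<subseteq> X \<and> continuous_on D ys \<and> (\<forall>x\<in>D. kkt_point g k h x (ys x))"

end

theory Submission
  imports Defs
begin

text \<open>Near a point of the trajectory the inactive constraints stay inactive, and LICQ makes the
  multipliers of the formerly active constraints depend continuously on the point. By SCSC these
  multipliers are positive, hence they stay positive and complementarity keeps their constraints
  active. So the active set is locally constant along the trajectory.\<close>

section \<open>Continuity of smooth functions and of their partial gradients\<close>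

text \<open>Smoothness on \<open>X \<times> UNIV\<close> is given by extensions to open sets, so
  continuity comes first for the extension \<open>F\<close> and is then transferred to
  \<open>f\<close>, which agrees with \<open>F\<close> on \<open>S\<close> near
  \<open>s\<close>.\<close>

lemma continuous_on_local_extension:
  fixes f :: "'a::t2_space \<Rightarrow> 'b::topological_space"
  assumes "\<And>s. s \<in> S \<Longrightarrow> \<exists>U F. open U \<and> s \<in> U \<and> continuous_on U F \<and> (\<forall>z\<in>S \<inter> U. F z = f z)"
  shows "continuous_on S f"
  unfolding continuous_on_def
proof
  fix s assume s: "s \<in> S"
  then obtain U F where U: "open U" "s \<in> U" "continuous_on U F" "\<forall>z\<in>S \<inter> U. F z = f z"
    using assms by meson
  then have "isCont F s"
    by (simp add: continuous_on_eq_continuous_at)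
  then have "(F \<longlongrightarrow> F s) (at s within S)"
    unfolding continuous_within[symmetric] by (rule continuous_at_imp_continuous_at_within)
  moreover have "eventually (\<lambda>z. F z = f z) (at s within S)"
    unfolding eventually_at_topological using U by blast
  ultimately have "(f \<longlongrightarrow> F s) (at s within S)"
    by (rule Lim_transform_eventually)
  then show "(f \<longlongrightarrow> f s) (at s within S)"
    using U s by simp
qed

lemma smooth_on_imp_continuous_on:
  assumes "smooth_on S f"
  shows "continuous_on S f"
proof (rule continuous_on_local_extension)
  fix s assume "s \<in> S"
  then show "\<exists>U F. open U \<and> s \<in> U \<and> continuous_on U F \<and> (\<forall>z\<in>S \<inter> U. F z = f z)"
    using assms unfolding smooth_on_def Cinf_on_def by (metis Cr_on.simps(1))
qed

text \<open>Replaces the definite description in \<open>grad\<close> by directional derivatives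
  along the basis, which are the quantities whose continuity \<open>Cr_on\<close> provides.\<close>

lemma grad_eq_sum_Basis:
  fixes f :: "'b::euclidean_space \<Rightarrow> real"
  assumes "(f has_derivative f') (at y)"
  shows "grad f y = (\<Sum>b\<in>Basis. f' b *\<^sub>R b)"
proof -
  define D where "D = (\<Sum>b\<in>Basis. f' b *\<^sub>R b)"
  have "linear f'"
    using assms by (rule has_derivative_linear)
  have "f' v = v \<bullet> D" for v
  proof -
    have "f' v = f' (\<Sum>b\<in>Basis. (v \<bullet> b) *\<^sub>R b)"
      by (simp add: euclidean_representation)
    also have "\<dots> = (\<Sum>b\<in>Basis. (v \<bullet> b) * f' b)"
      using \<open>linear f'\<close> by (simp add: linear_sum linear_scale)
    also have "\<dots> = v \<bullet> D"
      by (simp add: D_def inner_sum_right mult.commute)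
    finally show ?thesis .
  qed
  then have "f' = (\<lambda>v. v \<bullet> D)"
    by (rule ext)
  with assms have "GDERIV f y :> D"
    by (simp only: gderiv_def)
  then have "grad f y = D"
    unfolding grad_def
  proof (rule the_equality)
    fix E assume "GDERIV f y :> E"
    then have "(\<lambda>v. v \<bullet> E) = (\<lambda>v. v \<bullet> D)"
      using \<open>GDERIV f y :> D\<close> unfolding gderiv_def by (rule has_derivative_unique)
    then show "E = D"
      by (metis vector_eq_ldot)
  qed
  then show ?thesis
    by (simp only: D_def)
qed

text \<open>Only \<open>y\<close>-derivatives occur, and for \<open>x \<in> X\<close> the whole
  slice over \<open>x\<close> lies in \<open>X \<times> UNIV\<close>. Hence the gradient in
  \<open>y\<close> can be read off any local extension, even where \<open>X\<close> has empty
  interior.\<close>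

lemma continuous_on_partial_grad:
  fixes f :: "'a::euclidean_space \<Rightarrow> 'b::euclidean_space \<Rightarrow> real"
  assumes "smooth_on (X \<times> UNIV) (\<lambda>(x, y). f x y)"
  shows "continuous_on (X \<times> UNIV) (\<lambda>(x, y). grad (f x) y)"
proof (rule continuous_on_local_extension)
  fix s :: "'a \<times> 'b" assume "s \<in> X \<times> UNIV"
  then obtain U F where U: "open U" "s \<in> U" "Cinf_on U F"
    and "\<forall>z\<in>X \<times> UNIV \<inter> U. F z = (\<lambda>(x, y). f x y) z"
    using assms unfolding smooth_on_def by blast
  then have F: "F (x, y) = f x y" if "x \<in> X" "(x, y) \<in> U" for x y
    using that by auto
  have "Cr_on (Suc 0) U F"
    using U(3) by (simp only: Cinf_on_def)
  then have diff: "\<And>z. z \<in> U \<Longrightarrow> F differentiable (at z)"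
    and cont: "\<And>v. continuous_on U (\<lambda>z. frechet_derivative F (at z) v)"
    unfolding Cr_on.simps by blast+
  let ?G = "\<lambda>z. \<Sum>b\<in>Basis. frechet_derivative F (at z) (0, b) *\<^sub>R b"
  have "continuous_on U ?G"
    by (rule continuous_on_sum, rule continuous_on_scaleR[OF cont continuous_on_const])
  moreover have "?G (x, y) = grad (f x) y" if "x \<in> X" "(x, y) \<in> U" for x y
  proof -
    have "(F has_derivative frechet_derivative F (at (x, y))) (at (x, y))"
      using diff[OF that(2)] by (simp add: frechet_derivative_works)
    moreover have "((\<lambda>y. (x, y)) has_derivative (\<lambda>v. (0, v))) (at y)"
      by (auto intro!: derivative_eq_intros)
    ultimately have "((\<lambda>y. F (x, y)) has_derivative
        (\<lambda>v. frechet_derivative F (at (x, y)) (0, v))) (at y)"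
      by (rule has_derivative_compose[rotated])
    \<comment> \<open>On this open set of \<open>y\<close> the slice of \<open>F\<close> equals
      \<open>f x\<close>, so both have the same derivative at \<open>y\<close>.\<close>
    moreover have "open (Pair x -` U)"
      using U(1) by (intro open_vimage continuous_intros)
    ultimately have "(f x has_derivative (\<lambda>v. frechet_derivative F (at (x, y)) (0, v))) (at y)"
      using that by (auto intro: has_derivative_transform_within_open simp: F)
    then show ?thesis
      by (simp add: grad_eq_sum_Basis)
  qed
  ultimately show "\<exists>U F. open U \<and> s \<in> U \<and> continuous_on U F \<and>
      (\<forall>z\<in>X \<times> UNIV \<inter> U. F z = (\<lambda>(x, y). grad (f x) y) z)"
    using U by (intro exI[of _ U] exI[of _ ?G]) auto
qed

section \<open>Positivity of multipliers under perturbation\<close>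

text \<open>The component \<open>z\<close> of \<open>G j\<close> orthogonal to the span of the other
  vectors is nonzero by independence; dividing it by its squared norm gives
  \<open>w\<close>.\<close>

lemma dual_vector_exists:
  fixes G :: "'i \<Rightarrow> 'b::euclidean_space"
  assumes "inj_on G J" "independent (G ` J)" "j \<in> J"
  obtains w where "w \<bullet> G j = 1" "\<And>i. i \<in> J \<Longrightarrow> i \<noteq> j \<Longrightarrow> w \<bullet> G i = 0"
proof -
  let ?S = "G ` (J - {j})"
  \<comment> \<open>Injectivity is what lets removal of the index \<open>j\<close> coincide with
    removal of the vector \<open>G j\<close>, the form used by \<open>dependent_def\<close>.\<close>
  have "?S = G ` J - {G j}"
    using assms by (auto simp: inj_on_def)
  then have notin: "G j \<notin> span ?S"
    using assms by (auto simp: dependent_def)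
  obtain y z where y: "y \<in> span ?S" and z: "\<And>v. v \<in> span ?S \<Longrightarrow> orthogonal z v"
    and eq: "G j = y + z"
    using orthogonal_subspace_decomp_exists by metis
  have "z \<noteq> 0"
    using notin y eq by auto
  have "z \<bullet> G j = z \<bullet> z"
    using z[OF y] by (simp add: eq inner_add_right orthogonal_def)
  with \<open>z \<noteq> 0\<close> have "(z /\<^sub>R (z \<bullet> z)) \<bullet> G j = 1"
    by simp
  moreover have "(z /\<^sub>R (z \<bullet> z)) \<bullet> G i = 0" if "i \<in> J" "i \<noteq> j" for i
    using z[of "G i"] that by (auto simp: orthogonal_def span_base)
  ultimately show ?thesis
    using that by blast
qed

text \<open>Testing the stationarity condition against vectors dual to the limit gradients turns it into
  a linear system for the multipliers that is a small perturbation of the identity.\<close>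

lemma eventually_multipliers_pos:
  fixes G :: "'i \<Rightarrow> 'c \<Rightarrow> 'b::euclidean_space"
  assumes "finite J"
    and inj: "inj_on G0 J" and indep: "independent (G0 ` J)"
    and G: "\<And>i. i \<in> J \<Longrightarrow> (G i \<longlongrightarrow> G0 i) F"
    and \<gamma>: "(\<gamma> \<longlongrightarrow> \<gamma>0) F"
    and stat0: "\<gamma>0 + (\<Sum>i\<in>J. l0 i *\<^sub>R G0 i) = 0"
    and pos: "\<And>i. i \<in> J \<Longrightarrow> l0 i > 0"
  shows "\<forall>\<^sub>F x in F. \<forall>l. (\<forall>i\<in>J. l i \<ge> 0) \<longrightarrow> \<gamma> x + (\<Sum>i\<in>J. l i *\<^sub>R G i x) = 0 \<longrightarrow> (\<forall>i\<in>J. l i > 0)"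
proof -
  have "\<exists>w. \<forall>i\<in>J. w \<bullet> G0 i = (if i = j then 1 else 0)" if "j \<in> J" for j
    using dual_vector_exists[OF inj indep that] by metis
  then obtain w where w: "\<And>i j. i \<in> J \<Longrightarrow> j \<in> J \<Longrightarrow> w j \<bullet> G0 i = (if i = j then 1 else 0)"
    by metis
  \<comment> \<open>Pairing the limit stationarity equation with \<open>w j\<close> isolates the
    multiplier \<open>l0 j\<close>.\<close>
  have w\<gamma>: "w j \<bullet> \<gamma>0 = - l0 j" if "j \<in> J" for j
  proof -
    have "0 = w j \<bullet> (\<gamma>0 + (\<Sum>i\<in>J. l0 i *\<^sub>R G0 i))"
      by (simp add: stat0)
    also have "\<dots> = w j \<bullet> \<gamma>0 + (\<Sum>i\<in>J. l0 i * (if i = j then 1 else 0))"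
      using that by (simp add: inner_add_right inner_sum_right w)
    finally show ?thesis
      using that \<open>finite J\<close> by (simp add: if_distrib cong: if_cong)
  qed
  define S0 where "S0 = (\<Sum>i\<in>J. l0 i)"
  have "S0 \<ge> 0"
    unfolding S0_def using pos by (auto intro: sum_nonneg less_imp_le)
  \<comment> \<open>The first element bounds \<open>card J * \<epsilon>\<close> by one half, which
    will bound the sum of the multipliers; it also keeps \<open>E\<close> nonempty when
    \<open>J\<close> is empty. The others keep the final error below each \<open>l0 j\<close>, with
    3 in place of 2 making that inequality strict.\<close>
  define E where "E = insert (1 / (2 * (card J + 1))) ((\<lambda>i. l0 i / (2 * S0 + 3)) ` J)"
  define \<epsilon> where "\<epsilon> = Min E"
  have E: "finite E" "E \<noteq> {}" "\<And>e. e \<in> E \<Longrightarrow> e > 0"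
    using \<open>finite J\<close> pos \<open>S0 \<ge> 0\<close> by (auto simp: E_def)
  then have "\<epsilon> > 0"
    by (simp add: \<epsilon>_def)
  have "\<epsilon> \<le> 1 / (2 * (card J + 1))"
    unfolding \<epsilon>_def using E by (auto simp: E_def)
  then have \<epsilon>_card: "2 * card J * \<epsilon> \<le> 1"
    using \<open>\<epsilon> > 0\<close> by (simp add: field_simps)
  have \<epsilon>_l0: "\<epsilon> * (2 * S0 + 2) < l0 j" if "j \<in> J" for j
  proof -
    have "\<epsilon> \<le> l0 j / (2 * S0 + 3)"
      unfolding \<epsilon>_def by (rule Min_le) (use E that in \<open>auto simp: E_def\<close>)
    then have "\<epsilon> * (2 * S0 + 3) \<le> l0 j"
      using \<open>S0 \<ge> 0\<close> by (simp add: field_simps)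
    with \<open>\<epsilon> > 0\<close> show ?thesis
      by (simp add: algebra_simps)
  qed
  have "\<forall>\<^sub>F x in F. \<forall>j\<in>J. \<forall>i\<in>J. dist (w j \<bullet> G i x) (w j \<bullet> G0 i) < \<epsilon>"
    using \<open>finite J\<close> \<open>\<epsilon> > 0\<close>
    by (intro eventually_ball_finite ballI tendstoD tendsto_intros G) auto
  moreover have "\<forall>\<^sub>F x in F. \<forall>j\<in>J. dist (w j \<bullet> \<gamma> x) (w j \<bullet> \<gamma>0) < \<epsilon>"
    using \<open>finite J\<close> \<open>\<epsilon> > 0\<close>
    by (intro eventually_ball_finite ballI tendstoD tendsto_intros \<gamma>) auto
  ultimately show ?thesis
  proof eventually_elim
    case (elim x)
    show ?case
    proof (intro allI impI)
      fix l assume l: "\<forall>i\<in>J. l i \<ge> 0" and stat: "\<gamma> x + (\<Sum>i\<in>J. l i *\<^sub>R G i x) = 0"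
      define S where "S = (\<Sum>i\<in>J. l i)"
      \<comment> \<open>Pairing the perturbed equation with \<open>w j\<close> gives
        \<open>l j\<close> up to an error of \<epsilon> from \<open>\<gamma>\<close> and \<epsilon>
        times each multiplier from the gradients. The bound still contains the unknown sum
        \<open>S\<close>.\<close>
      have near: "\<bar>l j - l0 j\<bar> \<le> \<epsilon> * (1 + S)" if j: "j \<in> J" for j
      proof -
        have "0 = w j \<bullet> (\<gamma> x + (\<Sum>i\<in>J. l i *\<^sub>R G i x))"
          by (simp add: stat)
        also have "\<dots> = w j \<bullet> \<gamma> x + (\<Sum>i\<in>J. l i * (w j \<bullet> G i x))"
          by (simp add: inner_add_right inner_sum_right)
        also have "(\<Sum>i\<in>J. l i * (w j \<bullet> G i x)) =
            (\<Sum>i\<in>J. l i * (w j \<bullet> G i x - w j \<bullet> G0 i)) + (\<Sum>i\<in>J. l i * (w j \<bullet> G0 i))"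
          by (simp add: sum.distrib[symmetric] algebra_simps)
        also have "(\<Sum>i\<in>J. l i * (w j \<bullet> G0 i)) = l j"
          using j \<open>finite J\<close> by (simp add: w if_distrib cong: if_cong)
        finally have "l j - l0 j =
            - (w j \<bullet> \<gamma> x - w j \<bullet> \<gamma>0) - (\<Sum>i\<in>J. l i * (w j \<bullet> G i x - w j \<bullet> G0 i))"
          using w\<gamma>[OF j] by simp
        moreover have "\<bar>\<Sum>i\<in>J. l i * (w j \<bullet> G i x - w j \<bullet> G0 i)\<bar> \<le> (\<Sum>i\<in>J. l i * \<epsilon>)"
        proof (rule order_trans[OF sum_abs sum_mono])
          fix i assume i: "i \<in> J"
          then have "\<bar>w j \<bullet> G i x - w j \<bullet> G0 i\<bar> \<le> \<epsilon>"
            using elim(1) j by (force simp: dist_real_def)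
          then show "\<bar>l i * (w j \<bullet> G i x - w j \<bullet> G0 i)\<bar> \<le> l i * \<epsilon>"
            using l i by (simp add: abs_mult mult_left_mono)
        qed
        moreover have "\<bar>w j \<bullet> \<gamma> x - w j \<bullet> \<gamma>0\<bar> < \<epsilon>"
          using elim(2) j by (simp add: dist_real_def)
        moreover have "(\<Sum>i\<in>J. l i * \<epsilon>) = \<epsilon> * S"
          by (simp add: S_def sum_distrib_left mult.commute)
        ultimately show ?thesis
          by (simp add: algebra_simps)
      qed
      have "S \<ge> 0"
        unfolding S_def using l by (simp add: sum_nonneg)
      \<comment> \<open>Summing the estimates over \<open>J\<close> leaves at most half of
        \<open>1 + S\<close> on the right, which is absorbed on the left and bounds \<open>S\<close>
        in terms of \<open>S0\<close> alone.\<close>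
      have "S - S0 = (\<Sum>j\<in>J. l j - l0 j)"
        by (simp add: S_def S0_def sum_subtractf)
      also have "\<dots> \<le> (\<Sum>j\<in>J. \<epsilon> * (1 + S))"
        by (rule sum_mono) (use near in fastforce)
      also have "\<dots> = (card J * \<epsilon>) * (1 + S)"
        by simp
      also have "\<dots> \<le> (1 / 2) * (1 + S)"
        using \<epsilon>_card \<open>S \<ge> 0\<close> by (intro mult_right_mono) auto
      finally have "1 + S \<le> 2 * S0 + 2"
        by simp
      show "\<forall>j\<in>J. l j > 0"
      proof
        fix j assume j: "j \<in> J"
        have "\<epsilon> * (1 + S) \<le> \<epsilon> * (2 * S0 + 2)"
          using \<open>1 + S \<le> 2 * S0 + 2\<close> \<open>\<epsilon> > 0\<close> by simp
        with near[OF j] \<epsilon>_l0[OF j] show "l j > 0"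
          by linarith
      qed
    qed
  qed
qed

section \<open>Local constancy of the active set\<close>

text \<open>LICQ and SCSC enter at the base point \<open>x0\<close>; nearby multipliers inherit
  their positivity from the perturbation estimate.\<close>

lemma eventually_active_eq:
  fixes g :: "'a::euclidean_space \<Rightarrow> 'b::euclidean_space \<Rightarrow> real"
  assumes g: "smooth_on (X \<times> UNIV) (\<lambda>(x, y). g x y)"
    and h: "\<And>i. i \<in> {1..k} \<Longrightarrow> smooth_on (X \<times> UNIV) (\<lambda>(x, y). h i x y)"
    and traj: "kkt_trajectory g k h X D ys"
    and x0: "x0 \<in> D" and licq: "LICQ k h x0" and scsc: "SCSC g k h x0"
  shows "\<forall>\<^sub>F x in at x0 within D. active k h x0 (ys x0) = active k h x (ys x)"
proof -
  define J where "J = active k h x0 (ys x0)"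
  have J: "finite J" "J \<subseteq> {1..k}"
    by (auto simp: J_def active_def)
  have D: "D \<subseteq> X" "continuous_on D ys" and kkt: "\<And>x. x \<in> D \<Longrightarrow> kkt_point g k h x (ys x)"
    using traj by (auto simp: kkt_trajectory_def)
  have along: "((\<lambda>x. f x (ys x)) \<longlongrightarrow> f x0 (ys x0)) (at x0 within D)"
    if "continuous_on (X \<times> UNIV) (\<lambda>(x, y). f x y)" for f :: "'a \<Rightarrow> 'b \<Rightarrow> 'c::topological_space"
  proof -
    have "continuous_on D (\<lambda>x. (\<lambda>(x, y). f x y) (x, ys x))"
      by (rule continuous_on_compose2[OF that]) (use D in \<open>auto intro!: continuous_intros\<close>)
    then show ?thesis
      using x0 by (simp add: continuous_on_def)
  qed
  \<comment> \<open>Complementarity kills the multipliers outside \<open>J\<close>, so stationarity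
    involves the same index set \<open>J\<close> at \<open>x0\<close> and at nearby points.\<close>
  have reduce: "grad (g x) y + (\<Sum>i\<in>J. l i *\<^sub>R grad (h i x) y) = 0"
    if "kkt_pair g k h x y l" "\<forall>i\<in>{1..k} - J. h i x y < 0" for x y l
  proof -
    have "(\<Sum>i\<in>J. l i *\<^sub>R grad (h i x) y) = (\<Sum>i\<in>{1..k}. l i *\<^sub>R grad (h i x) y)"
      by (rule sum.mono_neutral_left) (use that J in \<open>force simp: kkt_pair_def\<close>)+
    then show ?thesis
      using that by (simp add: kkt_pair_def)
  qed
  obtain l0 where l0: "kkt_pair g k h x0 (ys x0) l0"
    using kkt[OF x0] by (auto simp: kkt_point_def)
  then have feas: "ys x0 \<in> feas k h x0"
    by (simp add: feas_def kkt_pair_def)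
  have inactive0: "\<forall>i\<in>{1..k} - J. h i x0 (ys x0) < 0"
    using feas by (auto simp: J_def active_def feas_def order_less_le)
  have pos: "l0 i > 0" if "i \<in> J" for i
  proof -
    have "i \<in> {1..k}" "h i x0 (ys x0) = 0"
      using that by (auto simp: J_def active_def)
    moreover have "h i x0 (ys x0) < 0 \<and> l0 i = 0 \<or> h i x0 (ys x0) = 0 \<and> l0 i > 0"
      using scsc l0 \<open>i \<in> {1..k}\<close> unfolding SCSC_def by blast
    ultimately show ?thesis
      by simp
  qed
  have "\<forall>\<^sub>F x in at x0 within D. \<forall>l. (\<forall>i\<in>J. l i \<ge> 0) \<longrightarrow>
      grad (g x) (ys x) + (\<Sum>i\<in>J. l i *\<^sub>R grad (h i x) (ys x)) = 0 \<longrightarrow> (\<forall>i\<in>J. l i > 0)"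
  proof (rule eventually_multipliers_pos)
    show "inj_on (\<lambda>i. grad (h i x0) (ys x0)) J"
      "independent ((\<lambda>i. grad (h i x0) (ys x0)) ` J)"
      using licq feas by (auto simp: LICQ_def J_def)
    show "((\<lambda>x. grad (h i x) (ys x)) \<longlongrightarrow> grad (h i x0) (ys x0)) (at x0 within D)" if "i \<in> J" for i
      using that J by (intro along[of "\<lambda>x. grad (h i x)"] continuous_on_partial_grad h) auto
    show "((\<lambda>x. grad (g x) (ys x)) \<longlongrightarrow> grad (g x0) (ys x0)) (at x0 within D)"
      by (intro along[of "\<lambda>x. grad (g x)"] continuous_on_partial_grad g)
  qed (use J pos reduce[OF l0 inactive0] in auto)
  moreover have "\<forall>\<^sub>F x in at x0 within D. \<forall>i\<in>{1..k} - J. h i x (ys x) < 0"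
    using inactive0
    by (intro eventually_ball_finite ballI order_tendstoD(2)[OF along]
        smooth_on_imp_continuous_on h) auto
  moreover have "\<forall>\<^sub>F x in at x0 within D. x \<in> D"
    by (simp add: eventually_at_filter)
  ultimately have "\<forall>\<^sub>F x in at x0 within D. J = active k h x (ys x)"
  proof eventually_elim
    case (elim x)
    obtain l where l: "kkt_pair g k h x (ys x) l"
      using kkt[OF elim(3)] by (auto simp: kkt_point_def)
    moreover have "\<forall>i\<in>J. l i \<ge> 0"
      using l J by (auto simp: kkt_pair_def)
    \<comment> \<open>The estimate covers all nonnegative solutions of the reduced equation, so an
      arbitrary choice of \<open>l\<close> at each \<open>x\<close> suffices, with no continuous
      selection.\<close>
    ultimately have "\<forall>i\<in>J. l i > 0"
      using elim(1) reduce[OF l elim(2)] by blast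
    then have "\<forall>i\<in>J. h i x (ys x) = 0"
      using l J unfolding kkt_pair_def by fastforce
    \<comment> \<open>No new constraint becomes active, since those outside \<open>J\<close> stay
      strictly negative near \<open>x0\<close>.\<close>
    moreover have "i \<in> J" if "i \<in> {1..k}" "h i x (ys x) = 0" for i
      using elim(2) that by force
    ultimately show ?case
      unfolding active_def using J(2) by blast
  qed
  then show ?thesis
    by (simp add: J_def)
qed

section \<open>Constancy on a connected domain\<close>

theorem theorem2p5:
  fixes X :: "(real^'n) set"
    and g :: "real^'n \<Rightarrow> real^'m \<Rightarrow> real"
    and k :: nat
    and h :: "nat \<Rightarrow> real^'n \<Rightarrow> real^'m \<Rightarrow> real"
    and D :: "(real^'n) set"
    and ys :: "real^'n \<Rightarrow> real^'m"
  assumes g_smooth: "smooth_on (X \<times> UNIV) (\<lambda>(x, y). g x y)"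
    and h_smooth: "\<And>i. i \<in> {1..k} \<Longrightarrow> smooth_on (X \<times> UNIV) (\<lambda>(x, y). h i x y)"
    and feas_nonempty: "\<And>x. x \<in> X \<Longrightarrow> feas k h x \<noteq> {}"
    and X_mgb: "mgb X"
    and X_connected: "connected X"
    and unif_bounded: "\<exists>R>0. \<forall>x\<in>X. feas k h x \<subseteq> {y. norm y \<le> R}"
    and licq: "\<And>x. x \<in> X \<Longrightarrow> LICQ k h x"
    and scsc: "\<And>x. x \<in> X \<Longrightarrow> SCSC g k h x"
    and traj: "kkt_trajectory g k h X D ys"
    and D_connected: "connected D"
  shows "(\<lambda>x. active k h x (ys x)) constant_on D \<and>
         (\<forall>J\<subseteq>{1..k}. \<forall>x\<in>D. \<forall>x'\<in>D. ys x \<in> stratum k h J x \<longrightarrow> ys x' \<in> stratum k h J x')"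
proof -
  have D: "D \<subseteq> X" and kkt: "\<And>x. x \<in> D \<Longrightarrow> kkt_point g k h x (ys x)"
    using traj by (auto simp: kkt_trajectory_def)
  have eq: "active k h x (ys x) = active k h x' (ys x')" if "x \<in> D" "x' \<in> D" for x x'
  \<comment> \<open>Connectedness of \<open>D\<close> turns local constancy of the active set into
    global constancy.\<close>
  proof (rule connected_local_const[OF D_connected that], rule ballI)
    fix x0 assume "x0 \<in> D"
    with D show "\<forall>\<^sub>F x in at x0 within D. active k h x0 (ys x0) = active k h x (ys x)"
      by (intro eventually_active_eq[OF g_smooth h_smooth traj] licq scsc) auto
  qed
  then have "(\<lambda>x. active k h x (ys x)) constant_on D"
    unfolding constant_on_def by metis
  \<comment> \<open>A stratum also requires feasibility, which is part of the KKT
    conditions.\<close>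
  moreover have "ys x \<in> feas k h x" if "x \<in> D" for x
    using kkt[OF that] by (auto simp: kkt_point_def kkt_pair_def feas_def)
  then have "ys x' \<in> stratum k h J x'" if "x \<in> D" "x' \<in> D" "ys x \<in> stratum k h J x" for J x x'
    using that eq[of x x'] by (simp add: stratum_def)
  ultimately show ?thesis
    by blast
qed

end
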